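(* Let $X$ be a Hausdorff topological space and let $Y$ be a Hausdorff locally convex linear topological space. Let $F$ be a set-valued map from $X$ to $Y$. Then the following are equivalent: (1) $F$ is a minimal cusco map; (2) $F$ has nonempty compact convex values, $F$ has a closed graph (in $X\times Y$), every extreme function of $F$ is quasicontinuous and subcontinuous, and any two extreme functions of $F$ have the same closures of their graphs in $X\times Y$; (3) $F$ has nonempty compact values, and every extreme function $f$ of $F$ is quasicontinuous, subcontinuous and satisfies $F(x) = \overline{\mathrm{co}}\,\overline{f}(x)$ for every $x \in X$.
   Context: Linear topological spaces are considered over the reals. A set-valued map (or map) $F$ from $X$ to $Y$ assigns to each $x\in X$ a (possibly empty) subset $F(x)\subset Y$; it is identified with its graph $\{(x,y)\in X\times Y: y\in F(x)\}$. For $U\subset X$, $F(U)=\bigcup\{F(u):u\in U\}$. For maps $F,G$, $G\subset F$ means $G(x)\subset F(x)$ for all $x\in X$. $F$ is upper semicontinuous if for every $x\in X$ and every open $V\supset F(x)$ there is an open neighborhood $U$ of $x$ with $F(U)\subset V$. $F$ is usco if it is upper semicontinuous with nonempty compact values; it is cusco if it is usco and every $F(x)$ is convex. $F$ is minimal cusco if it is cusco and does not properly contain any other cusco map from $X$ to $Y$. For a (not necessarily convex) set $B\subset Y$, $\mathcal{E}(B)$ is the set of extreme points of $B$: those $b\in B$ that cannot be written as $b=ty+(1-t)z$ with $y,z\in B$, $y\ne z$, $0<t<1$ (every nonempty compact subset of $Y$ has an extreme point). For a map $F$ with nonempty compact values, an extreme function of $F$ is a function $f:X\to Y$ with $f(x)\in\mathcal{E}(F(x))$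 for every $x\in X$. A function $f:X\to Y$ is quasicontinuous if for every $x\in X$, every neighborhood $V$ of $f(x)$ and every open neighborhood $U$ of $x$ there is a nonempty open set $G\subset U$ with $f(G)\subset V$. A function $f:X\to Y$ is subcontinuous if for every $x\in X$ and every net $(x_i)$ in $X$ converging to $x$, the net $(f(x_i))$ has a convergent subnet in $Y$. $\overline{f}$ denotes the closure of the graph of $f$ in $X\times Y$, and $\overline{f}(x)=\{y\in Y:(x,y)\in\overline{f}\}$. $\overline{\mathrm{co}}\,B$ is the closed convex hull of $B\subset Y$. *)

theory Defs
  imports "HOL-Analysis.Analysis"
begin

class topological_real_vector = real_vector + topological_ab_group_add +
  assumes tendsto_scaleR_nhds:
    "LIM p (nhds c \<times>\<^sub>F nhds a). fst p *\<^sub>R snd p :> nhds (c *\<^sub>R a)"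

(* Convex neighbourhoods need not be open. It suffices to ask for them at 0, by translation.
   The first conjunct is convex C written out: the class specification cannot refer to convex, which
   is fixed to sort real_vector. *)
class locally_convex_real_vector = topological_real_vector +
  assumes convex_nhds_0_raw: "open U \<Longrightarrow> 0 \<in> U \<Longrightarrow>
    \<exists>C. (\<forall>x\<in>C. \<forall>y\<in>C. \<forall>u\<ge>0. \<forall>v\<ge>0. u + v = 1 \<longrightarrow> u *\<^sub>R x + v *\<^sub>R y \<in> C) \<and>
      (\<exists>W. open W \<and> 0 \<in> W \<and> W \<subseteq> C) \<and> C \<subseteq> U"

lemma convex_nhds_0:
  fixes U :: "'a::locally_convex_real_vector set"
  assumes "open U" "0 \<in> U"
  obtains C where "convex C" "0 \<in> interior C" "C \<subseteq> U"
  using convex_nhds_0_raw[OF assms] unfolding convex_def interior_def by blast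

instance real_normed_vector \<subseteq> locally_convex_real_vector
proof
  fix c :: real and a :: 'a
  show "LIM p (nhds c \<times>\<^sub>F nhds a). fst p *\<^sub>R snd p :> nhds (c *\<^sub>R a)"
    by (intro tendsto_scaleR filterlim_fst filterlim_snd)
next
  fix U :: "'a set"
  assume "open U" "0 \<in> U"
  then obtain e where e: "e > 0" "ball 0 e \<subseteq> U"
    by (meson open_contains_ball)
  have "\<forall>x\<in>ball 0 e. \<forall>y\<in>ball 0 e. \<forall>u\<ge>0. \<forall>v\<ge>0. u + v = 1 \<longrightarrow> u *\<^sub>R x + v *\<^sub>R y \<in> ball (0::'a) e"
    using convex_ball[of "0::'a" e] unfolding convex_def .
  moreover have "\<exists>W. open W \<and> 0 \<in> W \<and> W \<subseteq> ball (0::'a) e"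
    using e(1) by (intro exI[of _ "ball 0 e"]) simp
  ultimately show "\<exists>C. (\<forall>x\<in>C. \<forall>y\<in>C. \<forall>u\<ge>0. \<forall>v\<ge>0. u + v = 1 \<longrightarrow> u *\<^sub>R x + v *\<^sub>R y \<in> C) \<and>
      (\<exists>W. open W \<and> 0 \<in> W \<and> W \<subseteq> C) \<and> C \<subseteq> U"
    using e(2) by blast
qed

definition usc :: "('a::topological_space \<Rightarrow> 'b::topological_space set) \<Rightarrow> bool"
  where "usc F \<longleftrightarrow>
    (\<forall>x V. open V \<and> F x \<subseteq> V \<longrightarrow> (\<exists>U. open U \<and> x \<in> U \<and> (\<Union>u\<in>U. F u) \<subseteq> V))"

definition usco :: "('a::topological_space \<Rightarrow> 'b::topological_space set) \<Rightarrow> bool"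
  where "usco F \<longleftrightarrow> usc F \<and> (\<forall>x. F x \<noteq> {} \<and> compact (F x))"

definition cusco :: "('a::topological_space \<Rightarrow> 'b::{topological_space, real_vector} set) \<Rightarrow> bool"
  where "cusco F \<longleftrightarrow> usco F \<and> (\<forall>x. convex (F x))"

definition minimal_cusco :: "('a::topological_space \<Rightarrow> 'b::{topological_space, real_vector} set) \<Rightarrow> bool"
  where "minimal_cusco F \<longleftrightarrow> cusco F \<and> (\<forall>G. cusco G \<and> (\<forall>x. G x \<subseteq> F x) \<longrightarrow> G = F)"

definition extreme_function :: "('a \<Rightarrow> 'b::real_vector set) \<Rightarrow> ('a \<Rightarrow> 'b) \<Rightarrow> bool"
  where "extreme_function F f \<longleftrightarrow> (\<forall>x. f x extreme_point_of F x)"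

definition quasicontinuous :: "('a::topological_space \<Rightarrow> 'b::topological_space) \<Rightarrow> bool"
  where "quasicontinuous f \<longleftrightarrow>
    (\<forall>x V U. f x \<in> interior V \<and> open U \<and> x \<in> U \<longrightarrow>
      (\<exists>G. open G \<and> G \<noteq> {} \<and> G \<subseteq> U \<and> f ` G \<subseteq> V))"

definition directed_by :: "'i set \<Rightarrow> ('i \<Rightarrow> 'i \<Rightarrow> bool) \<Rightarrow> bool"
  where "directed_by D le \<longleftrightarrow> D \<noteq> {} \<and> reflp_on D le \<and> transp_on D le \<and>
    (\<forall>i\<in>D. \<forall>j\<in>D. \<exists>k\<in>D. le i k \<and> le j k)"

definition net_converges ::
    "'i set \<Rightarrow> ('i \<Rightarrow> 'i \<Rightarrow> bool) \<Rightarrow> ('i \<Rightarrow> 'a::topological_space) \<Rightarrow> 'a \<Rightarrow> bool"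
  where "net_converges D le s y \<longleftrightarrow>
    (\<forall>V. open V \<and> y \<in> V \<longrightarrow> (\<exists>i\<in>D. \<forall>j\<in>D. le i j \<longrightarrow> s j \<in> V))"

(* A net s over (D, le) has the subnet s o phi over (E, le'), in the sense of Kelley. *)
definition subnet_map ::
    "'i set \<Rightarrow> ('i \<Rightarrow> 'i \<Rightarrow> bool) \<Rightarrow> 'k set \<Rightarrow> ('k \<Rightarrow> 'k \<Rightarrow> bool) \<Rightarrow> ('k \<Rightarrow> 'i) \<Rightarrow> bool"
  where "subnet_map D le E le' \<phi> \<longleftrightarrow> directed_by E le' \<and> \<phi> ` E \<subseteq> D \<and>
    (\<forall>i\<in>D. \<exists>k\<in>E. \<forall>l\<in>E. le' k l \<longrightarrow> le i (\<phi> l))"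

(* HOL cannot quantify over types inside a formula, so the type of the subnet's index set has to be
   fixed. The choice is no restriction: see has_convergent_subnetI below. *)
definition has_convergent_subnet ::
    "'i set \<Rightarrow> ('i \<Rightarrow> 'i \<Rightarrow> bool) \<Rightarrow> ('i \<Rightarrow> 'b::topological_space) \<Rightarrow> bool"
  where "has_convergent_subnet D le t \<longleftrightarrow>
    (\<exists>(E :: ('i \<times> 'b set) set) le' \<phi> y.
      subnet_map D le E le' \<phi> \<and> net_converges E le' (t \<circ> \<phi>) y)"

(* Likewise, nets indexed by subsets of 'a set * 'a are enough to test subcontinuity: the lemma
   subcontinuousD below recovers the property for nets over arbitrary directed sets. *)
definition subcontinuous :: "('a::topological_space \<Rightarrow> 'b::topological_space) \<Rightarrow> bool"
  where "subcontinuous f \<longleftrightarrow>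
    (\<forall>x (D :: ('a set \<times> 'a) set) le s.
      directed_by D le \<and> net_converges D le s x \<longrightarrow> has_convergent_subnet D le (f \<circ> s))"

definition closed_convex_hull :: "'b::{topological_space, real_vector} set \<Rightarrow> 'b set"
  where "closed_convex_hull B = closure (convex hull B)"

definition map_graph :: "('a \<Rightarrow> 'b set) \<Rightarrow> ('a \<times> 'b) set"
  where "map_graph F = {(x, y). y \<in> F x}"

definition fun_graph :: "('a \<Rightarrow> 'b) \<Rightarrow> ('a \<times> 'b) set"
  where "fun_graph f = {(x, y). y = f x}"

definition closure_map :: "('a::topological_space \<Rightarrow> 'b::topological_space) \<Rightarrow> 'a \<Rightarrow> 'b set"
  where "closure_map f x = {y. (x, y) \<in> closure (fun_graph f)}"

lemma subnet_cluster_point: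
  fixes E :: "'k set"
  assumes sub: "subnet_map D le E le' \<phi>" and conv: "net_converges E le' (t \<circ> \<phi>) y"
    and V: "open V" "y \<in> V" and i: "i \<in> D"
  shows "\<exists>j\<in>D. le i j \<and> t j \<in> V"
proof -
  obtain k where k: "k \<in> E" "\<forall>l\<in>E. le' k l \<longrightarrow> le i (\<phi> l)"
    using sub i unfolding subnet_map_def by blast
  obtain m where m: "m \<in> E" "\<forall>l\<in>E. le' m l \<longrightarrow> t (\<phi> l) \<in> V"
    using conv V unfolding net_converges_def by auto
  obtain l where l: "l \<in> E" "le' k l" "le' m l"
    using sub k(1) m(1) unfolding subnet_map_def directed_by_def by blast
  moreover have "\<phi> l \<in> D"
    using sub l(1) unfolding subnet_map_def by blast
  ultimately show ?thesis
    using k(2) m(2) by blast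
qed

lemma cluster_point_subnet:
  fixes t :: "'i \<Rightarrow> 'b::topological_space"
  assumes D: "directed_by D le"
    and cluster: "\<And>V i. open V \<Longrightarrow> y \<in> V \<Longrightarrow> i \<in> D \<Longrightarrow> \<exists>j\<in>D. le i j \<and> t j \<in> V"
  shows "has_convergent_subnet D le t"
proof -
  define E where "E = {(i, V). i \<in> D \<and> open V \<and> y \<in> V \<and> t i \<in> V}"
  define le' :: "'i \<times> 'b set \<Rightarrow> 'i \<times> 'b set \<Rightarrow> bool"
    where "le' = (\<lambda>p q. le (fst p) (fst q) \<and> snd q \<subseteq> snd p)"
  have refl: "le i i" if "i \<in> D" for i
    using D that unfolding directed_by_def by (blast dest: reflp_onD)
  have trans: "le i k" if "le i j" "le j k" "i \<in> D" "j \<in> D" "k \<in> D" for i j k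
    using D that unfolding directed_by_def by (blast dest: transp_onD)
  have ub: "\<exists>k\<in>D. le i k \<and> le j k" if "i \<in> D" "j \<in> D" for i j
    using D that unfolding directed_by_def by blast
  obtain i0 where i0: "i0 \<in> D"
    using D unfolding directed_by_def by blast
  have inE: "(i, UNIV) \<in> E" if "i \<in> D" for i
    using that by (simp add: E_def)
  have "reflp_on E le'"
    by (rule reflp_onI) (auto simp: E_def le'_def refl)
  moreover have "transp_on E le'"
    by (rule transp_onI) (auto simp: E_def le'_def intro: trans)
  moreover have "\<exists>r\<in>E. le' p r \<and> le' q r" if pq: "p \<in> E" "q \<in> E" for p q
  proof -
    obtain i V j W where eq: "p = (i, V)" "q = (j, W)"
      by (metis prod.collapse)
    have p: "i \<in> D" "open V" "y \<in> V" and q: "j \<in> D" "open W" "y \<in> W"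
      using pq by (auto simp: E_def eq)
    obtain k where k: "k \<in> D" "le i k" "le j k"
      using ub p(1) q(1) by blast
    obtain l where l: "l \<in> D" "le k l" "t l \<in> V \<inter> W"
      using cluster[of "V \<inter> W" k] p q k(1) by blast
    have "(l, V \<inter> W) \<in> E"
      using l p q by (auto simp: E_def)
    moreover have "le i l" "le j l"
      using trans k l p(1) q(1) by blast+
    ultimately show ?thesis
      by (intro bexI[of _ "(l, V \<inter> W)"]) (auto simp: eq le'_def)
  qed
  ultimately have "directed_by E le'"
    using inE[OF i0] unfolding directed_by_def by blast
  moreover have "fst ` E \<subseteq> D"
    by (auto simp: E_def)
  moreover have "\<exists>k\<in>E. \<forall>l\<in>E. le' k l \<longrightarrow> le i (fst l)" if "i \<in> D" for i
    by (rule bexI[OF _ inE[OF that]]) (simp add: le'_def)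
  ultimately have "subnet_map D le E le' fst"
    unfolding subnet_map_def by blast
  moreover have "net_converges E le' (t \<circ> fst) y"
    unfolding net_converges_def
  proof (intro allI impI)
    fix V assume V: "open V \<and> y \<in> V"
    then obtain j where j: "j \<in> D" "t j \<in> V"
      using cluster i0 by blast
    then have "(j, V) \<in> E"
      using V by (simp add: E_def)
    moreover have "\<forall>l\<in>E. le' (j, V) l \<longrightarrow> (t \<circ> fst) l \<in> V"
      by (auto simp: E_def le'_def)
    ultimately show "\<exists>i\<in>E. \<forall>j\<in>E. le' i j \<longrightarrow> (t \<circ> fst) j \<in> V"
      by blast
  qed
  ultimately show ?thesis
    unfolding has_convergent_subnet_def by blast
qed

lemma has_convergent_subnetI:
  fixes E :: "'k set"
  assumes "directed_by D le" "subnet_map D le E le' \<phi>" "net_converges E le' (t \<circ> \<phi>) y"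
  shows "has_convergent_subnet D le t"
  using cluster_point_subnet[OF assms(1)] subnet_cluster_point[OF assms(2,3)] by blast

lemma subcontinuousD:
  fixes f :: "'a::topological_space \<Rightarrow> 'b::topological_space" and D :: "'i set"
  assumes f: "subcontinuous f" and D: "directed_by D le" and s: "net_converges D le s x"
  shows "has_convergent_subnet D le (f \<circ> s)"
proof -
  define T where "T i = s ` {j \<in> D. le i j}" for i
  define D' where "D' = {(A, a). a \<in> A \<and> (\<exists>i\<in>D. A = T i)}"
  define le' :: "'a set \<times> 'a \<Rightarrow> 'a set \<times> 'a \<Rightarrow> bool" where "le' = (\<lambda>p q. fst q \<subseteq> fst p)"
  have refl: "le i i" if "i \<in> D" for i
    using D that unfolding directed_by_def by (blast dest: reflp_onD)
  have trans: "le i k" if "le i j" "le j k" "i \<in> D" "j \<in> D" "k \<in> D" for i j k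
    using D that unfolding directed_by_def by (blast dest: transp_onD)
  have ub: "\<exists>k\<in>D. le i k \<and> le j k" if "i \<in> D" "j \<in> D" for i j
    using D that unfolding directed_by_def by blast
  have mono: "T j \<subseteq> T i" if "le i j" "i \<in> D" "j \<in> D" for i j
    unfolding T_def using that by (blast intro: trans)
  have inD': "(T i, s i) \<in> D'" if "i \<in> D" for i
    using that refl[OF that] by (auto simp: D'_def T_def)
  have "\<exists>r\<in>D'. le' p r \<and> le' q r" if pq: "p \<in> D'" "q \<in> D'" for p q
  proof -
    obtain i j where "i \<in> D" "j \<in> D" and eq: "fst p = T i" "fst q = T j"
      using pq by (auto simp: D'_def)
    moreover from this obtain k where "k \<in> D" "le i k" "le j k"
      using ub by blast
    ultimately show ?thesis
      using mono inD' by (intro bexI[of _ "(T k, s k)"]) (simp_all add: le'_def)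
  qed
  moreover have "D' \<noteq> {}"
    using D inD' unfolding directed_by_def by blast
  moreover have "reflp_on D' le'" "transp_on D' le'"
    by (auto simp: le'_def intro!: reflp_onI transp_onI)
  ultimately have D'dir: "directed_by D' le'"
    unfolding directed_by_def by blast
  moreover have "net_converges D' le' snd x"
    unfolding net_converges_def
  proof (intro allI impI)
    fix V assume "open V \<and> x \<in> V"
    then obtain i where i: "i \<in> D" "\<forall>j\<in>D. le i j \<longrightarrow> s j \<in> V"
      using s unfolding net_converges_def by blast
    then have "T i \<subseteq> V"
      by (auto simp: T_def)
    then have "\<forall>q\<in>D'. le' (T i, s i) q \<longrightarrow> snd q \<in> V"
      by (auto simp: D'_def le'_def)
    then show "\<exists>p\<in>D'. \<forall>q\<in>D'. le' p q \<longrightarrow> snd q \<in> V"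
      using inD'[OF i(1)] by blast
  qed
  ultimately have "has_convergent_subnet D' le' (f \<circ> snd)"
    using f unfolding subcontinuous_def by blast
  then obtain E :: "(('a set \<times> 'a) \<times> 'b set) set" and leE \<phi> y
    where sub: "subnet_map D' le' E leE \<phi>" and conv: "net_converges E leE ((f \<circ> snd) \<circ> \<phi>) y"
    unfolding has_convergent_subnet_def by blast
  show ?thesis
  proof (rule cluster_point_subnet[OF D])
    fix V i assume V: "open V" "y \<in> V" and i: "i \<in> D"
    obtain q where "q \<in> D'" "le' (T i, s i) q" "(f \<circ> snd) q \<in> V"
      using subnet_cluster_point[OF sub conv V inD'[OF i]] by blast
    then have "snd q \<in> T i" "f (snd q) \<in> V"
      by (auto simp: D'_def le'_def)
    then show "\<exists>j\<in>D. le i j \<and> (f \<circ> s) j \<in> V"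
      by (auto simp: T_def)
  qed
qed

end

(* No separating functionals are used. A convex neighbourhood of 0 has an upper semicontinuous
   Minkowski functional, and its maximizers on a compact set form an extreme subset; with Zorn's lemma
   this gives an extreme point outside any open convex set that does not cover the compact set.

   (1) to (2): near an extreme point e of F x, minimality yields nonempty open sets G with F(G) inside
   any prescribed neighbourhood of e, so all extreme functions are quasicontinuous and approximate each
   other. (2) to (3): an extreme point of F x outside the closed convex hull would be a value of an
   extreme function with a larger graph closure. (3) to (1): if a cusco map G inside F misses an extreme
   point e of F x, an extreme function through e stays close to e on some nonempty open set, hence so
   does F, which is disjoint from G there. *)

theory Submission
  imports Defs
begin

section \<open>Topological vector spaces\<close>

lemma continuous_on_scaleR_tvs:
  fixes g :: "'a::topological_space \<Rightarrow> 'b::topological_real_vector"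
  assumes "continuous_on S f" "continuous_on S g"
  shows "continuous_on S (\<lambda>x. f x *\<^sub>R g x)"
proof -
  have "((\<lambda>x. f x *\<^sub>R g x) \<longlongrightarrow> c *\<^sub>R a) L" if "(f \<longlongrightarrow> c) L" "(g \<longlongrightarrow> a) L" for c a L
    using filterlim_compose[OF tendsto_scaleR_nhds filterlim_Pair[OF that]] by simp
  then show ?thesis
    using assms unfolding continuous_on_def by blast
qed

lemma open_vimage_affine:
  fixes S :: "'b::topological_real_vector set"
  assumes "open S"
  shows "open ((\<lambda>x. a + c *\<^sub>R x) -` S)"
  by (intro open_vimage assms continuous_on_add continuous_on_const continuous_on_scaleR_tvs
      continuous_on_id)

lemma open_image_affine:
  fixes S :: "'b::topological_real_vector set"
  assumes "open S" "c \<noteq> 0"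
  shows "open ((\<lambda>x. a + c *\<^sub>R x) ` S)"
proof -
  have "(\<lambda>x. a + c *\<^sub>R x) ` S = (\<lambda>x. - (inverse c *\<^sub>R a) + inverse c *\<^sub>R x) -` S"
  proof safe
    fix y assume "- (inverse c *\<^sub>R a) + inverse c *\<^sub>R y \<in> S"
    moreover have "y = a + c *\<^sub>R (- (inverse c *\<^sub>R a) + inverse c *\<^sub>R y)"
      using assms(2) by (simp add: algebra_simps)
    ultimately show "y \<in> (\<lambda>x. a + c *\<^sub>R x) ` S"
      by blast
  qed (use assms(2) in \<open>simp add: algebra_simps\<close>)
  then show ?thesis
    using open_vimage_affine[OF assms(1)] by metis
qed

lemma open_set_plus:
  fixes S W :: "'b::topological_real_vector set"
  assumes "open W"
  shows "open (S + W)"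
proof -
  have "S + W = (\<Union>a\<in>S. (\<lambda>x. a + 1 *\<^sub>R x) ` W)"
    by (auto simp: set_plus_def)
  then show ?thesis
    using open_image_affine[OF assms, of 1] by (metis (no_types, lifting) open_UN one_neq_zero)
qed

text \<open>Contracting \<open>interior S\<close> towards a point of \<open>S\<close> by a nonzero
  factor \<open>u\<close> yields an open subset of \<open>S\<close>, hence a subset of
  \<open>interior S\<close>.\<close>

lemma convex_interior_tvs:
  fixes S :: "'b::topological_real_vector set"
  assumes "convex S"
  shows "convex (interior S)"
  unfolding convex_alt
proof (intro ballI allI impI)
  fix x y and u :: real
  assume x: "x \<in> interior S" and y: "y \<in> interior S" and u: "0 \<le> u \<and> u \<le> 1"
  show "(1 - u) *\<^sub>R x + u *\<^sub>R y \<in> interior S"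
  proof (cases "u = 0")
    case False
    let ?T = "(\<lambda>z. (1 - u) *\<^sub>R x + u *\<^sub>R z) ` interior S"
    have "?T \<subseteq> S"
      using x u interior_subset[of S] assms unfolding convex_alt by blast
    then show ?thesis
      using open_image_affine[OF open_interior False] y by (metis imageI interior_maximal subsetD)
  qed (use x in simp)
qed

text \<open>By symmetry of \<open>W\<close>, a point of \<open>S\<close> in \<open>{y} + W\<close>
  puts \<open>y\<close> into \<open>S + W\<close>.\<close>

lemma closure_subset_set_plus:
  fixes S W :: "'b::topological_real_vector set"
  assumes "open W" "0 \<in> W" "\<And>w. w \<in> W \<Longrightarrow> - w \<in> W"
  shows "closure S \<subseteq> S + W"
proof
  fix y assume y: "y \<in> closure S"
  have "open ({y} + W)" "y \<in> {y} + W"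
    using open_set_plus[OF assms(1), of "{y}"] assms(2) by (auto intro: set_plus_intro[of y _ 0, simplified])
  then have "({y} + W) \<inter> S \<noteq> {}"
    using open_Int_closure_eq_empty y by fastforce
  then obtain w where "w \<in> W" "y + w \<in> S"
    by (auto simp: set_plus_def)
  then have "(y + w) + (- w) \<in> S + W"
    using assms(3) by (intro set_plus_intro)
  then show "y \<in> S + W"
    by simp
qed

lemma convex_closure_tvs:
  fixes S :: "'b::topological_real_vector set"
  assumes "convex S"
  shows "convex (closure S)"
  unfolding convex_alt
proof (intro ballI allI impI)
  fix x y and u :: real
  assume x: "x \<in> closure S" and y: "y \<in> closure S" and u: "0 \<le> u \<and> u \<le> 1"
  let ?h = "\<lambda>p. (1 - u) *\<^sub>R fst p + u *\<^sub>R snd p"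
  have "continuous_on (closure (S \<times> S)) ?h"
    by (intro continuous_on_add continuous_on_scaleR_tvs continuous_on_const continuous_on_fst
        continuous_on_snd continuous_on_id)
  moreover have "?h ` (S \<times> S) \<subseteq> closure S"
    using assms u closure_subset[of S] unfolding convex_alt by fastforce
  ultimately have "?h ` closure (S \<times> S) \<subseteq> closure S"
    by (intro image_closure_subset) auto
  moreover have "(x, y) \<in> closure (S \<times> S)"
    using x y by (simp add: closure_Times)
  ultimately show "(1 - u) *\<^sub>R x + u *\<^sub>R y \<in> closure S"
    by fastforce
qed

section \<open>Convex neighbourhoods in locally convex spaces\<close>

lemma convex_nhds_0_triple:
  fixes U :: "'b::locally_convex_real_vector set"
  assumes "open U" "0 \<in> U"
  obtains W where "open W" "convex W" "0 \<in> W" "\<And>w. w \<in> W \<Longrightarrow> - w \<in> W" "W + W + W \<subseteq> U"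
proof -
  obtain C where C: "convex C" "0 \<in> interior C" "C \<subseteq> U"
    using convex_nhds_0[OF assms] .
  \<comment> \<open>A sum of three points of \<open>C\<close> scaled by 1/3 is an average of points
    of \<open>C\<close>; intersecting with the reflected set gives symmetry.\<close>
  define W where "W = (\<lambda>x. 0 + 3 *\<^sub>R x) -` interior C \<inter> (\<lambda>x. 0 + (-3) *\<^sub>R x) -` interior C"
  have "open W"
    unfolding W_def by (intro open_Int open_vimage_affine open_interior)
  moreover have "convex W"
    unfolding W_def using convex_interior_tvs[OF C(1)]
    by (intro convex_Int convex_linear_vimage) (auto intro!: linearI simp: algebra_simps)
  moreover have "0 \<in> W" "\<And>w. w \<in> W \<Longrightarrow> - w \<in> W"
    using C(2) by (auto simp: W_def)
  moreover have "W + W + W \<subseteq> U"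
  proof
    fix z assume "z \<in> W + W + W"
    then obtain a b c where z: "z = a + b + c" "a \<in> W" "b \<in> W" "c \<in> W"
      by (auto elim!: set_plus_elim)
    then have abc: "3 *\<^sub>R a \<in> C" "3 *\<^sub>R b \<in> C" "3 *\<^sub>R c \<in> C"
      using interior_subset[of C] by (auto simp: W_def)
    have "(1/2) *\<^sub>R (3 *\<^sub>R a) + (1/2) *\<^sub>R (3 *\<^sub>R b) \<in> C"
      using abc by (intro convexD[OF C(1)]) auto
    then have "(2/3) *\<^sub>R ((1/2) *\<^sub>R (3 *\<^sub>R a) + (1/2) *\<^sub>R (3 *\<^sub>R b)) + (1/3) *\<^sub>R (3 *\<^sub>R c) \<in> C"
      using abc by (intro convexD[OF C(1)]) auto
    also have "(2/3) *\<^sub>R ((1/2) *\<^sub>R (3 *\<^sub>R a) + (1/2) *\<^sub>R (3 *\<^sub>R b)) + (1/3) *\<^sub>R (3 *\<^sub>R c) = z"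
      by (simp add: z(1) algebra_simps)
    finally show "z \<in> U"
      using C(3) by blast
  qed
  ultimately show ?thesis
    using that by blast
qed

text \<open>Compactness yields one symmetric convex \<open>W0\<close> with
  \<open>K + W0 + W0 \<subseteq> V\<close>, and \<open>Q = K + W0\<close> works. With
  \<open>V\<close> the complement of a point, this separates that point from
  \<open>K\<close>.\<close>

lemma compact_convex_nhds:
  fixes K :: "'b::locally_convex_real_vector set"
  assumes K: "compact K" "convex K" and V: "open V" "K \<subseteq> V"
  obtains Q where "open Q" "convex Q" "K \<subseteq> Q" "closure Q \<subseteq> V"
proof -
  have "\<exists>W. open W \<and> convex W \<and> 0 \<in> W \<and> (\<forall>w\<in>W. - w \<in> W) \<and> {k} + (W + W + W) \<subseteq> V"
    if "k \<in> K" for k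
  proof -
    have "open ((\<lambda>x. k + 1 *\<^sub>R x) -` V)" "0 \<in> (\<lambda>x. k + 1 *\<^sub>R x) -` V"
      using open_vimage_affine[OF V(1), of k 1] V(2) that by (simp_all add: subsetD)
    then obtain W where W: "open W" "convex W" "0 \<in> W" "\<And>w. w \<in> W \<Longrightarrow> - w \<in> W"
      "W + W + W \<subseteq> (\<lambda>x. k + 1 *\<^sub>R x) -` V"
      by (rule convex_nhds_0_triple) (rule that)
    have "{k} + (W + W + W) \<subseteq> V"
    proof
      fix z assume "z \<in> {k} + (W + W + W)"
      then obtain w where "w \<in> W + W + W" "z = k + w"
        by (rule set_plus_elim) auto
      then show "z \<in> V"
        using W(5) by auto
    qed
    then show ?thesis
      using W(1-4) by blast
  qed
  then obtain W where W: "\<And>k. k \<in> K \<Longrightarrow> open (W k) \<and> convex (W k) \<and> 0 \<in> W k \<and>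
      (\<forall>w\<in>W k. - w \<in> W k) \<and> {k} + (W k + W k + W k) \<subseteq> V"
    by metis
  have "K \<subseteq> (\<Union>k\<in>K. {k} + W k)"
    using W by (force simp: set_plus_def)
  then obtain K' where K': "K' \<subseteq> K" "finite K'" "K \<subseteq> (\<Union>k\<in>K'. {k} + W k)"
    using compactE_image[OF K(1), of K "\<lambda>k. {k} + W k"] W open_set_plus by metis
  \<comment> \<open>The three summands of \<open>W k\<close> pay for moving from \<open>K\<close> to
    the finite set \<open>K'\<close>, for the enlargement of \<open>K\<close>, and for its
    closure.\<close>
  define W0 where "W0 = (\<Inter>k\<in>K'. W k)"
  have W0: "open W0" "convex W0" "0 \<in> W0" "\<And>w. w \<in> W0 \<Longrightarrow> - w \<in> W0"
    using W K'(1,2) unfolding W0_def by (auto intro!: open_INT convex_INT)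
  have "K + W0 + W0 \<subseteq> V"
  proof
    fix z assume "z \<in> K + W0 + W0"
    then obtain k v w where z: "z = k + v + w" "k \<in> K" "v \<in> W0" "w \<in> W0"
      by (auto elim!: set_plus_elim)
    then obtain k' u where k': "k' \<in> K'" "u \<in> W k'" "k = k' + u"
      using K'(3) by (auto elim!: set_plus_elim)
    have "k' + (u + v + w) \<in> {k'} + (W k' + W k' + W k')"
      using k' z by (intro set_plus_intro) (auto simp: W0_def)
    then show "z \<in> V"
      using W K'(1) k' z(1) by (metis add.assoc subsetD)
  qed
  moreover have "closure (K + W0) \<subseteq> K + W0 + W0"
    using W0 by (intro closure_subset_set_plus) auto
  moreover have "K \<subseteq> K + W0"
    using W0(3) by (force simp: set_plus_def)
  ultimately show ?thesis
    using that[of "K + W0"] open_set_plus W0 convex_set_plus[OF K(2)] by blast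
qed

section \<open>Convex hulls of two nonempty convex sets, as joins\<close>

definition join :: "'b::real_vector set \<Rightarrow> 'b set \<Rightarrow> 'b set"
  where "join A B = {u *\<^sub>R a + v *\<^sub>R b | u v a b. 0 \<le> u \<and> 0 \<le> v \<and> u + v = 1 \<and> a \<in> A \<and> b \<in> B}"

text \<open>Rescaling by the total weight gives a convex combination. If that weight vanishes, any
  point of \<open>A\<close> serves; this can occur in \<open>convex_join\<close>.\<close>

lemma convex_cone_combination:
  assumes "convex A" "a \<in> A" "a' \<in> A" "0 \<le> p" "0 \<le> q"
  obtains c where "c \<in> A" "p *\<^sub>R a + q *\<^sub>R a' = (p + q) *\<^sub>R c"
proof (cases "p + q = 0")
  case True
  then have "p = 0" "q = 0"
    using assms(4,5) by auto
  then show ?thesis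
    using that[OF assms(2)] by simp
next
  case False
  have "(p / (p + q)) *\<^sub>R a + (q / (p + q)) *\<^sub>R a' \<in> A"
    using assms False by (intro convexD) (auto simp flip: add_divide_distrib)
  moreover have "p *\<^sub>R a + q *\<^sub>R a' = (p + q) *\<^sub>R ((p / (p + q)) *\<^sub>R a + (q / (p + q)) *\<^sub>R a')"
    using False by (simp add: scaleR_add_right)
  ultimately show ?thesis
    using that by blast
qed

lemma convex_join:
  assumes A: "convex A" and B: "convex B"
  shows "convex (join A B)"
proof (rule convexI)
  fix x y and s t :: real
  assume xy: "x \<in> join A B" "y \<in> join A B" and st: "0 \<le> s" "0 \<le> t" "s + t = 1"
  obtain u v a b where x: "x = u *\<^sub>R a + v *\<^sub>R b" "0 \<le> u" "0 \<le> v" "u + v = 1" "a \<in> A" "b \<in> B"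
    using xy(1) unfolding join_def by blast
  obtain u' v' a' b' where y: "y = u' *\<^sub>R a' + v' *\<^sub>R b'" "0 \<le> u'" "0 \<le> v'" "u' + v' = 1"
      "a' \<in> A" "b' \<in> B"
    using xy(2) unfolding join_def by blast
  obtain c where c: "c \<in> A" "(s * u) *\<^sub>R a + (t * u') *\<^sub>R a' = (s * u + t * u') *\<^sub>R c"
    using convex_cone_combination[OF A x(5) y(5), of "s * u" "t * u'"] x y st by auto
  obtain d where d: "d \<in> B" "(s * v) *\<^sub>R b + (t * v') *\<^sub>R b' = (s * v + t * v') *\<^sub>R d"
    using convex_cone_combination[OF B x(6) y(6), of "s * v" "t * v'"] x y st by auto
  have "s *\<^sub>R x + t *\<^sub>R y = ((s * u) *\<^sub>R a + (t * u') *\<^sub>R a') + ((s * v) *\<^sub>R b + (t * v') *\<^sub>R b')"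
    by (simp add: x(1) y(1) scaleR_add_right)
  then have "s *\<^sub>R x + t *\<^sub>R y = (s * u + t * u') *\<^sub>R c + (s * v + t * v') *\<^sub>R d"
    using c(2) d(2) by simp
  moreover have "s * u + t * u' + (s * v + t * v') = s * (u + v) + t * (u' + v')"
    by (simp add: algebra_simps)
  then have "s * u + t * u' + (s * v + t * v') = 1"
    using st x(4) y(4) by simp
  moreover have "0 \<le> s * u + t * u'" "0 \<le> s * v + t * v'"
    using x y st by auto
  ultimately show "s *\<^sub>R x + t *\<^sub>R y \<in> join A B"
    unfolding join_def using c(1) d(1) by blast
qed

text \<open>A continuous image of the compact set \<open>{0..1} \<times> A \<times> B\<close>;
  convex hulls of compact sets need not be compact in general.\<close>

lemma compact_join:
  fixes A B :: "'b::topological_real_vector set"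
  assumes "compact A" "compact B"
  shows "compact (join A B)"
proof -
  let ?h = "\<lambda>p :: real \<times> 'b \<times> 'b. (1 - fst p) *\<^sub>R fst (snd p) + fst p *\<^sub>R snd (snd p)"
  have "continuous_on ({0..1} \<times> A \<times> B) ?h"
    by (intro continuous_on_add continuous_on_scaleR_tvs continuous_on_const continuous_on_diff
        continuous_on_fst continuous_on_snd continuous_on_id)
  then have "compact (?h ` ({0..1} \<times> A \<times> B))"
    by (rule compact_continuous_image) (intro compact_Times compact_Icc assms)
  also have "?h ` ({0..1} \<times> A \<times> B) = join A B"
  proof
    show "join A B \<subseteq> ?h ` ({0..1} \<times> A \<times> B)"
    proof
      fix z assume "z \<in> join A B"
      then obtain u v a b where z: "z = u *\<^sub>R a + v *\<^sub>R b" "0 \<le> u" "0 \<le> v" "u + v = 1" "a \<in> A" "b \<in> B"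
        unfolding join_def by blast
      moreover from z have "u = 1 - v" by simp
      ultimately show "z \<in> ?h ` ({0..1} \<times> A \<times> B)"
        by (intro image_eqI[of _ _ "(v, a, b)"]) auto
    qed
    show "?h ` ({0..1} \<times> A \<times> B) \<subseteq> join A B"
    proof clarify
      fix t :: real and a b assume "t \<in> {0..1}" "a \<in> A" "b \<in> B"
      then show "?h (t, a, b) \<in> join A B"
        unfolding join_def mem_Collect_eq
        by (intro exI[of _ "1 - t"] exI[of _ t] exI[of _ a] exI[of _ b]) auto
    qed
  qed
  finally show ?thesis .
qed

lemma join_subset: "convex C \<Longrightarrow> A \<subseteq> C \<Longrightarrow> B \<subseteq> C \<Longrightarrow> join A B \<subseteq> C"
  unfolding join_def by (blast intro: convexD)

lemma subset_join:
  assumes "A \<noteq> {}" "B \<noteq> {}"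
  shows "A \<subseteq> join A B" "B \<subseteq> join A B"
proof -
  obtain a b where "a \<in> A" "b \<in> B"
    using assms by blast
  then show "A \<subseteq> join A B" "B \<subseteq> join A B"
    unfolding join_def
    by (force intro: exI[of _ 1] exI[of _ 0])+
qed

text \<open>Weight 0 or 1, or equality of the two points, would place \<open>e\<close> in
  \<open>A\<close> or \<open>B\<close>; otherwise \<open>e\<close> is interior to a segment in
  \<open>C\<close>.\<close>

lemma extreme_point_not_in_join:
  assumes e: "e extreme_point_of C" and "A \<subseteq> C" "B \<subseteq> C" "e \<notin> A" "e \<notin> B"
  shows "e \<notin> join A B"
proof
  assume "e \<in> join A B"
  then obtain u v a b where z: "e = u *\<^sub>R a + v *\<^sub>R b" "0 \<le> u" "0 \<le> v" "u + v = 1" "a \<in> A" "b \<in> B"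
    unfolding join_def by blast
  have u: "u = 1 - v"
    using z(4) by simp
  have "v \<noteq> 0" "v \<noteq> 1"
    using z assms(4,5) by auto
  moreover have "a \<noteq> b"
    using z u assms(4) by (auto simp flip: scaleR_add_left)
  ultimately have "e \<in> open_segment a b"
    using z u unfolding in_segment by (auto intro!: exI[of _ v])
  then show False
    using e z assms(2,3) unfolding extreme_point_of_def by blast
qed

text \<open>The sets are joined one after another; since \<open>e\<close> is extreme, it is missed
  at each stage, and compactness and convexity persist.\<close>

lemma finite_Union_compact_convex_avoiding:
  fixes C :: "'b::topological_real_vector set"
  assumes "finite \<K>" and C: "convex C" and e: "e extreme_point_of C"
    and "\<And>K. K \<in> \<K> \<Longrightarrow> compact K \<and> convex K \<and> K \<subseteq> C \<and> e \<notin> K"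
  shows "\<exists>K. compact K \<and> convex K \<and> K \<subseteq> C \<and> e \<notin> K \<and> \<Union>\<K> \<subseteq> K"
  using assms(1,4)
proof (induction \<K>)
  case empty
  then show ?case by (intro exI[of _ "{}"]) auto
next
  case (insert A \<K>)
  then obtain K where K: "compact K" "convex K" "K \<subseteq> C" "e \<notin> K" "\<Union>\<K> \<subseteq> K"
    by auto
  have A: "compact A" "convex A" "A \<subseteq> C" "e \<notin> A"
    using insert.prems by auto
  consider "A = {}" | "K = {}" | "A \<noteq> {}" "K \<noteq> {}"
    by blast
  then show ?case
  proof cases
    case 1
    then show ?thesis using K by auto
  next
    case 2
    then show ?thesis using K A by (intro exI[of _ A]) auto
  next
    case 3
    then show ?thesis
      using K A compact_join convex_join join_subset[OF C] subset_join[OF 3]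
        extreme_point_not_in_join[OF e]
      by (intro exI[of _ "join A K"]) auto
  qed
qed

section \<open>Extreme points\<close>

text \<open>The infimum is a junk value unless \<open>C\<close> absorbs \<open>y\<close>, as every neighbourhood of \<open>0\<close> does.\<close>

definition minkowski :: "'b::real_vector set \<Rightarrow> 'b \<Rightarrow> real"
  where "minkowski C y = Inf {s. 0 < s \<and> inverse s *\<^sub>R y \<in> C}"

text \<open>Openness of \<open>C\<close> at 0 makes the set under the infimum nonempty, and 0 bounds
  it below, so the infimum is genuine. Whether it is attained does not matter.\<close>

lemma minkowski_less_iff:
  fixes C :: "'b::topological_real_vector set"
  assumes C: "open C" "0 \<in> C"
  shows "minkowski C y < r \<longleftrightarrow> (\<exists>s. 0 < s \<and> s < r \<and> inverse s *\<^sub>R y \<in> C)"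
proof -
  have "open ((\<lambda>t::real. t *\<^sub>R y) -` C)"
    by (intro open_vimage C continuous_on_scaleR_tvs continuous_on_const continuous_on_id)
  moreover have "0 \<in> (\<lambda>t::real. t *\<^sub>R y) -` C"
    using C by simp
  ultimately obtain d :: real where d: "d > 0" "ball 0 d \<subseteq> (\<lambda>t. t *\<^sub>R y) -` C"
    by (meson open_contains_ball)
  have "inverse (2 / d) \<in> ball 0 d"
    using d(1) by simp
  then have "inverse (2 / d) *\<^sub>R y \<in> C"
    using d(2) by blast
  then have "2 / d \<in> {s. 0 < s \<and> inverse s *\<^sub>R y \<in> C}"
    using d(1) by simp
  then have ne: "{s. 0 < s \<and> inverse s *\<^sub>R y \<in> C} \<noteq> {}"
    by blast
  have "bdd_below {s. 0 < s \<and> inverse s *\<^sub>R y \<in> C}"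
    by (rule bdd_belowI[of _ 0]) auto
  then show ?thesis
    unfolding minkowski_def using cInf_less_iff[OF ne] by auto
qed

lemma open_minkowski_less:
  fixes C :: "'b::topological_real_vector set"
  assumes C: "open C" "0 \<in> C"
  shows "open {y. minkowski C (y - a) < r}"
proof -
  have "{y. minkowski C (y - a) < r} =
      (\<Union>s\<in>{0<..<r}. (\<lambda>y. - (inverse s *\<^sub>R a) + inverse s *\<^sub>R y) -` C)"
    by (auto simp: minkowski_less_iff[OF C] scaleR_diff_right)
  then show ?thesis
    by (simp only:) (intro open_UN ballI open_vimage_affine C(1))
qed

text \<open>Strict bounds supply witnesses \<open>s < r\<close> and \<open>s' < r'\<close>. Division
  by \<open>w = (1 - t) * s + t * s'\<close> turns the combined point into a convex combination of
  two points of \<open>C\<close>.\<close>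

lemma minkowski_convex_less:
  fixes C :: "'b::topological_real_vector set"
  assumes C: "open C" "0 \<in> C" "convex C"
    and a: "minkowski C a < r" and b: "minkowski C b < r'" and t: "0 < t" "t < 1"
  shows "minkowski C ((1 - t) *\<^sub>R a + t *\<^sub>R b) < (1 - t) * r + t * r'"
proof -
  obtain s s' where s: "0 < s" "s < r" "inverse s *\<^sub>R a \<in> C"
    and s': "0 < s'" "s' < r'" "inverse s' *\<^sub>R b \<in> C"
    using a b minkowski_less_iff[OF C(1,2)] by blast
  define w where "w = (1 - t) * s + t * s'"
  have w: "0 < w"
    unfolding w_def using s s' t by (intro add_pos_pos mult_pos_pos) auto
  have "((1 - t) * s / w) *\<^sub>R (inverse s *\<^sub>R a) + (t * s' / w) *\<^sub>R (inverse s' *\<^sub>R b) \<in> C"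
  proof (rule convexD[OF C(3) s(3) s'(3)])
    show "(1 - t) * s / w + t * s' / w = 1"
      using w by (simp add: add_divide_distrib[symmetric] w_def)
  qed (use w s s' t in auto)
  moreover have "(1 - t) * s / w * inverse s = inverse w * (1 - t)" "t * s' / w * inverse s' = inverse w * t"
    using w s(1) s'(1) by (simp_all add: field_simps)
  then have "((1 - t) * s / w) *\<^sub>R (inverse s *\<^sub>R a) + (t * s' / w) *\<^sub>R (inverse s' *\<^sub>R b) =
      inverse w *\<^sub>R ((1 - t) *\<^sub>R a + t *\<^sub>R b)"
    by (simp add: scaleR_add_right)
  ultimately have "inverse w *\<^sub>R ((1 - t) *\<^sub>R a + t *\<^sub>R b) \<in> C"
    by simp
  moreover have "w < (1 - t) * r + t * r'"
    unfolding w_def using s s' t by (intro add_strict_mono mult_strict_left_mono) auto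
  ultimately show ?thesis
    using minkowski_less_iff[OF C(1,2)] w by blast
qed

text \<open>A witness below 1 is handled by shrinking towards 0; conversely, openness of
  \<open>C\<close> lets \<open>y\<close> be stretched by a factor above 1 within
  \<open>C\<close>.\<close>

lemma minkowski_less_1_iff:
  fixes C :: "'b::topological_real_vector set"
  assumes C: "open C" "0 \<in> C" "convex C"
  shows "minkowski C y < 1 \<longleftrightarrow> y \<in> C"
proof
  assume "minkowski C y < 1"
  then obtain s where s: "0 < s" "s < 1" "inverse s *\<^sub>R y \<in> C"
    using minkowski_less_iff[OF C(1,2)] by blast
  then have "s *\<^sub>R (inverse s *\<^sub>R y) + (1 - s) *\<^sub>R 0 \<in> C"
    using C by (intro convexD) auto
  then show "y \<in> C"
    using s by simp
next
  assume y: "y \<in> C"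
  have "open ((\<lambda>t::real. t *\<^sub>R y) -` C)"
    by (intro open_vimage C continuous_on_scaleR_tvs continuous_on_const continuous_on_id)
  moreover have "1 \<in> (\<lambda>t::real. t *\<^sub>R y) -` C"
    using y by simp
  ultimately obtain d :: real where d: "d > 0" "ball 1 d \<subseteq> (\<lambda>t. t *\<^sub>R y) -` C"
    by (meson open_contains_ball)
  have "1 + d / 2 \<in> ball 1 d"
    using d(1) by (simp add: dist_real_def)
  then have "inverse (inverse (1 + d / 2)) *\<^sub>R y \<in> C"
    using d(2) by auto
  moreover have "0 < inverse (1 + d / 2)" "inverse (1 + d / 2) < 1"
    using d(1) by (auto intro!: inverse_less_1_iff[THEN iffD2] add_pos_pos)
  ultimately show "minkowski C y < 1"
    using minkowski_less_iff[OF C(1,2)] by blast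
qed

text \<open>Without a maximizer the open sets \<open>{x. p x < p m}\<close> for
  \<open>m \<in> A\<close> would cover \<open>A\<close>; but the index of largest value in a finite
  subcover lies in none of its members.\<close>

lemma compact_attains_max_usc:
  fixes p :: "'b::topological_space \<Rightarrow> 'c::linorder"
  assumes "compact A" "A \<noteq> {}" "\<And>r. open {x. p x < r}"
  obtains m where "m \<in> A" "\<And>x. x \<in> A \<Longrightarrow> p x \<le> p m"
proof (rule ccontr)
  assume "\<not> thesis"
  then have "A \<subseteq> (\<Union>m\<in>A. {x. p x < p m})"
    using that by force
  then obtain D where D: "D \<subseteq> A" "finite D" "A \<subseteq> (\<Union>m\<in>D. {x. p x < p m})"
    using compactE_image[OF assms(1), of A "\<lambda>m. {x. p x < p m}"] assms(3) by metis
  then have "D \<noteq> {}"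
    using assms(2) by auto
  then have "Max (p ` D) \<in> p ` D"
    using D(2) by simp
  then obtain m where m: "m \<in> D" "p m = Max (p ` D)"
    by force
  then obtain n where "n \<in> D" "p m < p n"
    using D by blast
  then show False
    using m D(2) by (metis Max_ge finite_imageI imageI leD)
qed

section \<open>Extreme subsets of compact sets and their minimal members\<close>

text \<open>Not \<^const>\<open>face_of\<close>: that predicate asks for convexity of \<open>B\<close>, which may fail here.\<close>

definition extreme_subset :: "'b::real_vector set \<Rightarrow> 'b set \<Rightarrow> bool"
  where "extreme_subset B A \<longleftrightarrow> B \<subseteq> A \<and>
    (\<forall>a\<in>A. \<forall>b\<in>A. \<forall>x\<in>B. x \<in> open_segment a b \<longrightarrow> a \<in> B \<and> b \<in> B)"

lemma extreme_subset_trans: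
  "extreme_subset D B \<Longrightarrow> extreme_subset B A \<Longrightarrow> extreme_subset D A"
  unfolding extreme_subset_def by blast

lemma extreme_subset_Inter:
  "\<C> \<noteq> {} \<Longrightarrow> (\<And>B. B \<in> \<C> \<Longrightarrow> extreme_subset B A) \<Longrightarrow> extreme_subset (\<Inter>\<C>) A"
  unfolding extreme_subset_def by blast

text \<open>The maximizers of a convex function form an extreme subset; the Minkowski functional of \<open>Q\<close> about a point of
  \<open>Q\<close> therefore does the work of a separating functional.\<close>

lemma extreme_subset_avoiding:
  fixes A :: "'b::{t2_space, topological_real_vector} set"
  assumes A: "compact A" and Q: "open Q" "convex Q" "q \<in> Q" and nsub: "\<not> A \<subseteq> Q"
  obtains B where "closed B" "B \<noteq> {}" "extreme_subset B A" "B \<inter> Q = {}"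
proof -
  define C where "C = (\<lambda>x. q + 1 *\<^sub>R x) -` Q"
  have "C = (\<lambda>x. x - q) ` Q"
  proof
    show "C \<subseteq> (\<lambda>x. x - q) ` Q"
    proof
      fix x assume "x \<in> C"
      then show "x \<in> (\<lambda>x. x - q) ` Q"
        by (intro image_eqI[of _ _ "q + x"]) (simp_all add: C_def)
    qed
  qed (auto simp: C_def)
  then have "convex C"
    using convex_translation_subtract[OF Q(2)] by simp
  then have C: "open C" "0 \<in> C" "convex C"
    unfolding C_def using open_vimage_affine[OF Q(1)] Q(3) by (blast, simp, blast)
  define p where "p x = minkowski C (x - q)" for x
  have p_open: "open {x. p x < r}" for r
    unfolding p_def by (rule open_minkowski_less[OF C(1,2)])
  have p_Q: "p x < 1 \<longleftrightarrow> x \<in> Q" for x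
    unfolding p_def minkowski_less_1_iff[OF C] by (simp add: C_def)
  have "A \<noteq> {}"
    using nsub by blast
  then obtain m where m: "m \<in> A" "\<And>x. x \<in> A \<Longrightarrow> p x \<le> p m"
    using compact_attains_max_usc[OF A _ p_open] by blast
  define B where "B = A \<inter> - {x. p x < p m}"
  have "closed B"
    unfolding B_def using compact_imp_closed[OF A] p_open by (intro closed_Int) auto
  moreover have "m \<in> B"
    using m by (simp add: B_def)
  moreover have "B \<inter> Q = {}"
  proof -
    \<comment> \<open>\<open>Q\<close> is exactly the set where \<open>p\<close> is below 1; a point
      of \<open>A\<close> outside it forces the maximum to be at least 1.\<close>
    obtain a where "a \<in> A" "\<not> p a < 1"
      using nsub p_Q by blast
    then have "\<not> p x < 1" if "x \<in> B" for x
      using that m(2)[of a] by (auto simp: B_def)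
    then show ?thesis
      using p_Q by blast
  qed
  moreover have "extreme_subset B A"
  proof -
    have less: "p ((1 - t) *\<^sub>R a + t *\<^sub>R b) < p m"
      if ab: "b \<in> A" "p a < p m" and t: "0 < t" "t < 1" for a b and t :: real
    proof -
      obtain r where r: "p a < r" "r < p m"
        using ab(2) dense by blast
      \<comment> \<open>Chosen so that the bound from \<open>minkowski_convex_less\<close> becomes
        exactly \<open>p m\<close>; as \<open>r < p m\<close>, this puts \<open>r'\<close> above
        \<open>p m\<close>, hence above \<open>p b\<close>.\<close>
      define r' where "r' = (p m - (1 - t) * r) / t"
      have "(1 - t) * r < (1 - t) * p m"
        using r t by simp
      then have "p m < r'"
        using t by (simp add: r'_def field_simps)
      then have "p b < r'"
        using m(2)[OF ab(1)] by simp
      then have "minkowski C ((1 - t) *\<^sub>R (a - q) + t *\<^sub>R (b - q)) < (1 - t) * r + t * r'"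
        using r by (intro minkowski_convex_less C t) (auto simp: p_def)
      moreover have "(1 - t) *\<^sub>R (a - q) + t *\<^sub>R (b - q) = (1 - t) *\<^sub>R a + t *\<^sub>R b - q"
        by (simp add: algebra_simps)
      moreover have "(1 - t) * r + t * r' = p m"
        using t by (simp add: r'_def)
      ultimately show ?thesis
        by (simp add: p_def)
    qed
    have "a \<in> B" if "a \<in> A" "b \<in> A" "x \<in> B" "x \<in> open_segment a b" for a b x
      using that less[of b a] by (auto simp: B_def in_segment)
    then show ?thesis
      unfolding extreme_subset_def by (metis B_def IntD1 open_segment_commute subsetI)
  qed
  ultimately show ?thesis
    using that by blast
qed

text \<open>A minimal nonempty closed extreme subset missing \<open>Q\<close> is a single point: of
  two points, one has a convex open neighbourhood excluding the other, and a smaller extreme subset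
  missing it could be cut out.\<close>

lemma extreme_point_outside:
  fixes A :: "'b::{t2_space, locally_convex_real_vector} set"
  assumes A: "compact A" and Q: "open Q" "convex Q" and nsub: "\<not> A \<subseteq> Q"
  obtains e where "e extreme_point_of A" "e \<notin> Q"
proof -
  define \<B> where "\<B> = {B. closed B \<and> B \<noteq> {} \<and> extreme_subset B A \<and> B \<inter> Q = {}}"
  \<comment> \<open>The starting set for Zorn's lemma. The Minkowski functional needs a point of
    \<open>Q\<close>, so for empty \<open>Q\<close> the set \<open>A\<close> itself is
    taken.\<close>
  obtain B0 where B0: "B0 \<in> \<B>"
  proof (cases "Q = {}")
    case True
    then have "A \<in> \<B>"
      using nsub compact_imp_closed[OF A] by (auto simp: \<B>_def extreme_subset_def)
    then show ?thesis
      using that by blast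
  next
    case False
    then show ?thesis
      using extreme_subset_avoiding[OF A Q _ nsub] that by (auto simp: \<B>_def)
  qed
  have "\<exists>M\<in>\<B>. \<forall>B\<in>\<B>. B \<subseteq> M \<longrightarrow> B = M"
  proof (rule predicate_Zorn)
    \<comment> \<open>Inclusion is reversed, so a maximal element is a minimal set.\<close>
    show "partial_order_on \<B> (relation_of (\<lambda>X Y. Y \<subseteq> X) \<B>)"
      by (rule partial_order_on_relation_ofI) auto
  next
    fix \<C> assume ch: "\<C> \<in> Chains (relation_of (\<lambda>X Y. Y \<subseteq> X) \<B>)"
    then have sub: "\<C> \<subseteq> \<B>" and lin: "\<And>X Y. X \<in> \<C> \<Longrightarrow> Y \<in> \<C> \<Longrightarrow> X \<subseteq> Y \<or> Y \<subseteq> X"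
      unfolding Chains_def relation_of_def by blast+
    show "\<exists>M\<in>\<B>. \<forall>B\<in>\<C>. M \<subseteq> B"
    proof (cases "\<C> = {}")
      case True
      then show ?thesis using B0 by blast
    next
      case False
      \<comment> \<open>Below finitely many members of a chain lies another member, nonempty and
        contained in \<open>A\<close>; this feeds the finite intersection property.\<close>
      have fin: "\<exists>X\<in>\<C>. \<forall>Y\<in>\<F>. X \<subseteq> Y" if "finite \<F>" "\<F> \<subseteq> \<C>" for \<F>
        using that
      proof (induction \<F>)
        case empty
        then show ?case using False by blast
      next
        case (insert Y \<F>)
        then obtain X where X: "X \<in> \<C>" "\<forall>Y\<in>\<F>. X \<subseteq> Y"
          by auto
        moreover have "Y \<in> \<C>"
          using insert.prems by simp
        ultimately show ?case
          using lin[of X Y] by blast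
      qed
      have "A \<inter> \<Inter>\<C> \<noteq> {}"
      proof (rule compact_imp_fip[OF A])
        show "closed T" if "T \<in> \<C>" for T
          using sub that by (auto simp: \<B>_def)
        fix \<F> assume "finite \<F>" "\<F> \<subseteq> \<C>"
        then obtain X where "X \<in> \<C>" "X \<subseteq> \<Inter>\<F>"
          using fin by (meson Inter_greatest)
        moreover from this have "X \<noteq> {}" "X \<subseteq> A"
          using sub by (auto simp: \<B>_def extreme_subset_def)
        ultimately show "A \<inter> \<Inter>\<F> \<noteq> {}"
          by blast
      qed
      then have "\<Inter>\<C> \<noteq> {}"
        by blast
      moreover have "extreme_subset (\<Inter>\<C>) A"
        using sub by (intro extreme_subset_Inter[OF False]) (auto simp: \<B>_def)
      moreover have "closed (\<Inter>\<C>)" "\<Inter>\<C> \<inter> Q = {}"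
        using sub False by (auto simp: \<B>_def)
      ultimately have "\<Inter>\<C> \<in> \<B>"
        by (simp add: \<B>_def)
      then show ?thesis
        by blast
    qed
  qed
  then obtain M where M: "M \<in> \<B>" "\<And>B. B \<in> \<B> \<Longrightarrow> B \<subseteq> M \<Longrightarrow> B = M"
    by blast
  have MB: "closed M" "M \<noteq> {}" "extreme_subset M A" "M \<inter> Q = {}"
    using M(1) by (auto simp: \<B>_def)
  then have "compact M"
    using A by (metis compact_Int_closed extreme_subset_def inf.absorb_iff2)
  have single: "a = b" if ab: "a \<in> M" "b \<in> M" for a b
  proof (rule ccontr)
    assume "a \<noteq> b"
    then have "{a} \<subseteq> - {b}" "open (- {b})"
      by auto
    then obtain P where P: "open P" "convex P" "{a} \<subseteq> P" "closure P \<subseteq> - {b}"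
      using compact_convex_nhds[of "{a}" "- {b}"] by (metis compact_sing convex_singleton)
    then have "\<not> M \<subseteq> P"
      using ab closure_subset[of P] by blast
    then obtain B where B: "closed B" "B \<noteq> {}" "extreme_subset B M" "B \<inter> P = {}"
      using extreme_subset_avoiding[OF \<open>compact M\<close> P(1,2)] P(3) by blast
    then have "B \<subseteq> M"
      by (simp add: extreme_subset_def)
    moreover have "B \<in> \<B>"
      using B MB extreme_subset_trans[OF B(3) MB(3)] \<open>B \<subseteq> M\<close> by (auto simp: \<B>_def)
    ultimately show False
      using M(2) B(4) P(3) ab by blast
  qed
  obtain e where e: "e \<in> M"
    using MB(2) by blast
  have "e extreme_point_of A"
    unfolding extreme_point_of_def
  proof (intro conjI ballI notI)
    show "e \<in> A"
      using e MB(3) by (auto simp: extreme_subset_def)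
    fix a b assume "a \<in> A" "b \<in> A" and seg: "e \<in> open_segment a b"
    then have "a \<in> M" "b \<in> M"
      using MB(3) e unfolding extreme_subset_def by blast+
    then show False
      using single[of a b] seg by (simp add: open_segment_def)
  qed
  then show ?thesis
    using that e MB(4) by blast
qed

text \<open>This contains the Krein--Milman theorem: take \<open>D\<close> to be the closed convex hull of the extreme
  points.\<close>

lemma extreme_point_outside_closed:
  fixes A :: "'b::{t2_space, locally_convex_real_vector} set"
  assumes A: "compact A" and D: "closed D" "convex D" "D \<subseteq> A" "D \<noteq> A"
  obtains e where "e extreme_point_of A" "e \<notin> D"
proof -
  obtain y where y: "y \<in> A" "y \<notin> D"
    using D by blast
  have "compact D"
    using A D by (metis compact_Int_closed inf.absorb_iff2)
  then obtain Q where Q: "open Q" "convex Q" "D \<subseteq> Q" "closure Q \<subseteq> - {y}"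
    using compact_convex_nhds[of D "- {y}"] D y by auto
  then have "\<not> A \<subseteq> Q"
    using y closure_subset[of Q] by blast
  then show ?thesis
    using extreme_point_outside[OF A Q(1,2)] Q(3) that by blast
qed

lemma extreme_function_exists:
  fixes F :: "'a \<Rightarrow> 'b::{t2_space, locally_convex_real_vector} set"
  assumes "\<And>x. F x \<noteq> {} \<and> compact (F x)"
  obtains f where "extreme_function F f"
proof -
  have "\<exists>e. e extreme_point_of F x" for x
    using extreme_point_outside[of "F x" "{}"] assms[of x] by auto
  then show ?thesis
    using that unfolding extreme_function_def by metis
qed

section \<open>Set-valued maps\<close>

lemma closed_convex_hull_minimal:
  "B \<subseteq> S \<Longrightarrow> closed S \<Longrightarrow> convex S \<Longrightarrow> closed_convex_hull B \<subseteq> S"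
  unfolding closed_convex_hull_def by (intro closure_minimal hull_minimal)

lemma subset_closed_convex_hull: "B \<subseteq> closed_convex_hull B"
  unfolding closed_convex_hull_def using hull_subset closure_subset by (rule subset_trans)

lemma closed_closed_convex_hull: "closed (closed_convex_hull B)"
  by (simp add: closed_convex_hull_def)

lemma convex_closed_convex_hull:
  fixes B :: "'b::topological_real_vector set"
  shows "convex (closed_convex_hull B)"
  unfolding closed_convex_hull_def by (intro convex_closure_tvs convex_convex_hull)

lemma in_closure_fun_graph_iff:
  "(x, y) \<in> closure (fun_graph f) \<longleftrightarrow>
    (\<forall>U V. open U \<and> x \<in> U \<and> open V \<and> y \<in> V \<longrightarrow> (\<exists>u\<in>U. f u \<in> V))"
proof
  assume L: "(x, y) \<in> closure (fun_graph f)"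
  show "\<forall>U V. open U \<and> x \<in> U \<and> open V \<and> y \<in> V \<longrightarrow> (\<exists>u\<in>U. f u \<in> V)"
  proof (intro allI impI)
    fix U V assume UV: "open U \<and> x \<in> U \<and> open V \<and> y \<in> V"
    then have "(U \<times> V) \<inter> closure (fun_graph f) \<noteq> {}"
      using L by blast
    then have "(U \<times> V) \<inter> fun_graph f \<noteq> {}"
      using open_Int_closure_eq_empty[OF open_Times] UV by blast
    then show "\<exists>u\<in>U. f u \<in> V"
      by (auto simp: fun_graph_def)
  qed
next
  assume R: "\<forall>U V. open U \<and> x \<in> U \<and> open V \<and> y \<in> V \<longrightarrow> (\<exists>u\<in>U. f u \<in> V)"
  show "(x, y) \<in> closure (fun_graph f)"
  proof (rule ccontr)
    assume "(x, y) \<notin> closure (fun_graph f)"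
    then obtain U V where "open U" "open V" "(x, y) \<in> U \<times> V" "U \<times> V \<subseteq> - closure (fun_graph f)"
      using open_prod_elim[of "- closure (fun_graph f)" "(x, y)"]
      by (metis ComplI closed_closure open_Compl)
    moreover from this obtain u where "u \<in> U" "f u \<in> V"
      using R by blast
    moreover have "(u, f u) \<in> closure (fun_graph f)"
      using closure_subset by (force simp: fun_graph_def)
    ultimately show False
      by blast
  qed
qed

lemma closure_map_iff:
  "y \<in> closure_map f x \<longleftrightarrow>
    (\<forall>U V. open U \<and> x \<in> U \<and> open V \<and> y \<in> V \<longrightarrow> (\<exists>u\<in>U. f u \<in> V))"
  unfolding closure_map_def by (simp add: in_closure_fun_graph_iff)

lemma in_closure_map: "f x \<in> closure_map f x"
  unfolding closure_map_iff by blast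

lemma closure_map_subset_closure:
  assumes "open U" "x \<in> U" "f ` U \<subseteq> V"
  shows "closure_map f x \<subseteq> closure V"
proof
  fix y assume y: "y \<in> closure_map f x"
  show "y \<in> closure V"
  proof (rule ccontr)
    assume "y \<notin> closure V"
    then obtain u where "u \<in> U" "f u \<in> - closure V"
      using y assms(1,2) unfolding closure_map_iff by (metis ComplI closed_closure open_Compl)
    then show False
      using assms(3) closure_subset by blast
  qed
qed

lemma uscD:
  assumes "usc F" "open V" "F x \<subseteq> V"
  obtains U where "open U" "x \<in> U" "\<And>u. u \<in> U \<Longrightarrow> F u \<subseteq> V"
  using assms unfolding usc_def by (metis UN_subset_iff)

text \<open>For \<open>y\<close> outside \<open>F x\<close>, a convex open \<open>Q\<close> around
  \<open>F x\<close> has closure missing \<open>y\<close>; nearby values stay in \<open>Q\<close>,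
  so a product neighbourhood of \<open>(x, y)\<close> misses the graph.\<close>

lemma closed_map_graph_cusco:
  fixes F :: "'a::topological_space \<Rightarrow> 'b::{t2_space, locally_convex_real_vector} set"
  assumes F: "cusco F"
  shows "closed (map_graph F)"
  unfolding closed_def
proof (subst open_subopen, intro ballI)
  fix p assume p: "p \<in> - map_graph F"
  obtain x y where xy: "p = (x, y)" "y \<notin> F x"
    using p by (cases p) (auto simp: map_graph_def)
  then have "compact (F x)" "convex (F x)" "open (- {y})" "F x \<subseteq> - {y}"
    using F unfolding cusco_def usco_def by auto
  then obtain Q where Q: "open Q" "F x \<subseteq> Q" "closure Q \<subseteq> - {y}"
    by (rule compact_convex_nhds)
  obtain U where U: "open U" "x \<in> U" "\<And>u. u \<in> U \<Longrightarrow> F u \<subseteq> Q"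
    using F Q uscD unfolding cusco_def usco_def by metis
  have "U \<times> (- closure Q) \<subseteq> - map_graph F"
    using U(3) closure_subset[of Q] by (auto simp: map_graph_def)
  moreover have "open (U \<times> (- closure Q))" "p \<in> U \<times> (- closure Q)"
    using U Q(3) xy(1) by (auto intro!: open_Times)
  ultimately show "\<exists>T. open T \<and> p \<in> T \<and> T \<subseteq> - map_graph F"
    by blast
qed

section \<open>Nets and subcontinuity\<close>

lemma directed_by_upper_bound:
  assumes D: "directed_by D le" and "finite S" "S \<subseteq> D"
  shows "\<exists>k\<in>D. \<forall>i\<in>S. le i k"
  using assms(2,3)
proof (induction S)
  case empty
  then show ?case
    using D unfolding directed_by_def by blast
next
  case (insert i S)
  then obtain k where k: "k \<in> D" "\<forall>j\<in>S. le j k"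
    by auto
  obtain l where l: "l \<in> D" "le i l" "le k l"
    using D k(1) insert.prems unfolding directed_by_def by blast
  have "le j l" if "j \<in> S" for j
    using D k l that insert.prems unfolding directed_by_def by (meson insert_subset subsetD transp_onD)
  then show ?case
    using l by blast
qed

text \<open>If the values had no cluster point, finitely many open sets, each eventually avoided,
  would cover the compact set \<open>F x\<close>; by upper semicontinuity the values eventually lie
  in this cover.\<close>

lemma usco_selection_subcontinuous:
  fixes f :: "'a::topological_space \<Rightarrow> 'b::topological_space"
  assumes F: "usco F" and f: "\<And>x. f x \<in> F x"
  shows "subcontinuous f"
  unfolding subcontinuous_def
proof (intro allI impI)
  fix x and D :: "('a set \<times> 'a) set" and le and s :: "'a set \<times> 'a \<Rightarrow> 'a"
  assume Ds: "directed_by D le \<and> net_converges D le s x"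
  then have D: "directed_by D le" by blast
  show "has_convergent_subnet D le (f \<circ> s)"
  proof (rule ccontr)
    assume neg: "\<not> has_convergent_subnet D le (f \<circ> s)"
    have "\<exists>V i. open V \<and> y \<in> V \<and> i \<in> D \<and> (\<forall>j\<in>D. le i j \<longrightarrow> f (s j) \<notin> V)" for y
      using cluster_point_subnet[OF D, of y "f \<circ> s"] neg unfolding o_def by blast
    then obtain V i where V: "\<And>y. open (V y)" "\<And>y. y \<in> V y" "\<And>y. i y \<in> D"
        "\<And>y j. j \<in> D \<Longrightarrow> le (i y) j \<Longrightarrow> f (s j) \<notin> V y"
      by metis
    have "compact (F x)" "F x \<subseteq> (\<Union>y\<in>F x. V y)"
      using F V(2) unfolding usco_def by blast+
    then obtain K where K: "K \<subseteq> F x" "finite K" "F x \<subseteq> (\<Union>y\<in>K. V y)"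
      using compactE_image[of "F x" "F x" V] V(1) by metis
    have "usc F" "open (\<Union>y\<in>K. V y)"
      using F V(1) unfolding usco_def by blast+
    then obtain U where U: "open U" "x \<in> U" "\<And>u. u \<in> U \<Longrightarrow> F u \<subseteq> (\<Union>y\<in>K. V y)"
      using uscD[of F "\<Union>y\<in>K. V y" x] K(3) by blast
    obtain i0 where i0: "i0 \<in> D" "\<And>j. j \<in> D \<Longrightarrow> le i0 j \<Longrightarrow> s j \<in> U"
      using Ds U(1,2) unfolding net_converges_def by blast
    \<comment> \<open>An index beyond \<open>i0\<close>, where the values have entered the cover,
      and beyond all \<open>i y\<close> for \<open>y \<in> K\<close>, where they avoid each
      piece.\<close>
    obtain k where k: "k \<in> D" "\<forall>j\<in>insert i0 (i ` K). le j k"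
      using directed_by_upper_bound[OF D, of "insert i0 (i ` K)"] K(2) V(3) i0(1) by blast
    then have "f (s k) \<in> (\<Union>y\<in>K. V y)"
      using U(3) i0(2) f by blast
    then show False
      using V(4) k by blast
  qed
qed

text \<open>If \<open>f\<close> left \<open>V\<close> arbitrarily near \<open>x\<close>, such points
  would form a net tending to \<open>x\<close> whose values cluster at some \<open>y\<close>. Then
  \<open>y\<close> lies in \<open>closure_map f x\<close>, hence in the open \<open>V\<close> that
  the values avoid.\<close>

lemma subcontinuous_closure_map_usc:
  fixes f :: "'a::topological_space \<Rightarrow> 'b::topological_space"
  assumes f: "subcontinuous f" and V: "open V" "closure_map f x \<subseteq> V"
  obtains U where "open U" "x \<in> U" "f ` U \<subseteq> V"
proof (rule ccontr)
  assume "\<not> thesis"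
  then have bad: "\<exists>u\<in>U. f u \<notin> V" if "open U" "x \<in> U" for U
    using that \<open>\<And>U. open U \<Longrightarrow> x \<in> U \<Longrightarrow> f ` U \<subseteq> V \<Longrightarrow> thesis\<close> by blast
  \<comment> \<open>Neighbourhoods paired with witnesses: the net is \<open>snd\<close>, and the
    order looks only at the neighbourhoods.\<close>
  define D where "D = {(U, u). open U \<and> x \<in> U \<and> u \<in> U \<and> f u \<notin> V}"
  define le :: "'a set \<times> 'a \<Rightarrow> 'a set \<times> 'a \<Rightarrow> bool" where "le = (\<lambda>p q. fst q \<subseteq> fst p)"
  have inD: "\<exists>u. (U, u) \<in> D" if "open U" "x \<in> U" for U
    using bad[OF that] that by (auto simp: D_def)
  have "\<exists>k\<in>D. le i k \<and> le j k" if "i \<in> D" "j \<in> D" for i j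
  proof -
    obtain u where "(fst i \<inter> fst j, u) \<in> D"
      using inD[of "fst i \<inter> fst j"] \<open>i \<in> D\<close> \<open>j \<in> D\<close> unfolding D_def by fastforce
    then show ?thesis
      by (rule rev_bexI) (simp add: le_def)
  qed
  then have D: "directed_by D le"
    using inD[of UNIV] unfolding directed_by_def
    by (auto simp: le_def intro!: reflp_onI transp_onI)
  have "net_converges D le snd x"
    unfolding net_converges_def
  proof (intro allI impI)
    fix U assume "open U \<and> x \<in> U"
    then obtain u where "(U, u) \<in> D"
      using inD by blast
    then show "\<exists>i\<in>D. \<forall>j\<in>D. le i j \<longrightarrow> snd j \<in> U"
      by (intro bexI[of _ "(U, u)"]) (auto simp: D_def le_def)
  qed
  then obtain E :: "(('a set \<times> 'a) \<times> 'b set) set" and leE \<phi> y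
    where sub: "subnet_map D le E leE \<phi>" and conv: "net_converges E leE ((f \<circ> snd) \<circ> \<phi>) y"
    using f D unfolding subcontinuous_def has_convergent_subnet_def by blast
  have cluster: "\<exists>u\<in>U. f u \<in> W \<and> f u \<notin> V" if UW: "open U" "x \<in> U" "open W" "y \<in> W" for U W
  proof -
    obtain u where "(U, u) \<in> D"
      using inD UW by blast
    then obtain j where "j \<in> D" "le (U, u) j" "(f \<circ> snd) j \<in> W"
      using subnet_cluster_point[OF sub conv UW(3,4)] by blast
    then have "snd j \<in> U" "f (snd j) \<in> W" "f (snd j) \<notin> V"
      by (auto simp: D_def le_def)
    then show ?thesis
      by blast
  qed
  then have "y \<in> closure_map f x"
    unfolding closure_map_iff by blast
  then show False
    using cluster[of UNIV V] V by auto
qed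

text \<open>Near \<open>x\<close>, \<open>f\<close> stays in a convex open \<open>Q\<close> around
  \<open>F x\<close>. Graph closures and closed convex hulls do not leave \<open>closure Q\<close>,
  so neither does \<open>F\<close>.\<close>

lemma cusco_if_closed_convex_hull:
  fixes F :: "'a::topological_space \<Rightarrow> 'b::{t2_space, locally_convex_real_vector} set"
  assumes F: "\<And>x. F x \<noteq> {} \<and> compact (F x)" and f: "subcontinuous f"
    and eq: "\<And>x. F x = closed_convex_hull (closure_map f x)"
  shows "cusco F"
proof -
  have convex: "convex (F x)" for x
    unfolding eq by (rule convex_closed_convex_hull)
  have "usc F"
    unfolding usc_def
  proof (intro allI impI)
    fix x V assume "open V \<and> F x \<subseteq> V"
    then obtain Q where Q: "open Q" "convex Q" "F x \<subseteq> Q" "closure Q \<subseteq> V"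
      using compact_convex_nhds F convex by blast
    then have "closure_map f x \<subseteq> Q"
      using eq subset_closed_convex_hull by blast
    then obtain U where U: "open U" "x \<in> U" "f ` U \<subseteq> Q"
      using subcontinuous_closure_map_usc[OF f Q(1)] by blast
    have "F u \<subseteq> closure Q" if "u \<in> U" for u
      unfolding eq[of u] using closure_map_subset_closure[OF U(1) that U(3)] convex_closure_tvs[OF Q(2)]
      by (intro closed_convex_hull_minimal) auto
    then show "\<exists>U. open U \<and> x \<in> U \<and> \<Union> (F ` U) \<subseteq> V"
      using U Q(4) by blast
  qed
  then show ?thesis
    unfolding cusco_def usco_def using F convex by blast
qed

section \<open>Minimality and localization near extreme points\<close>

text \<open>Otherwise replacing \<open>F\<close> by \<open>F \<inter> C\<close> over \<open>U\<close> gives a smaller cusco map.\<close>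

lemma minimal_cusco_subset:
  fixes F :: "'a::topological_space \<Rightarrow> 'b::{topological_space, real_vector} set"
  assumes F: "minimal_cusco F" and U: "open U" and C: "closed C" "convex C"
    and meet: "\<And>u. u \<in> U \<Longrightarrow> F u \<inter> C \<noteq> {}" and x: "x \<in> U"
  shows "F x \<subseteq> C"
proof -
  define G where "G u = (if u \<in> U then F u \<inter> C else F u)" for u
  have cF: "usc F" "\<And>u. F u \<noteq> {}" "\<And>u. compact (F u)" "\<And>u. convex (F u)"
    using F unfolding minimal_cusco_def cusco_def usco_def by auto
  have GF: "G u \<subseteq> F u" for u
    by (simp add: G_def)
  have "usc G"
    unfolding usc_def
  proof (intro allI impI)
    fix u V assume V: "open V \<and> G u \<subseteq> V"
    show "\<exists>N. open N \<and> u \<in> N \<and> \<Union> (G ` N) \<subseteq> V"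
    proof (cases "u \<in> U")
      case True
      \<comment> \<open>Inside \<open>U\<close>, whatever escapes \<open>V\<close> is removed by
        intersecting with \<open>C\<close>, so \<open>F\<close> only has to be kept in the open set
        \<open>V \<union> - C\<close>.\<close>
      then have "F u \<subseteq> V \<union> - C"
        using V by (auto simp: G_def)
      moreover have "open (V \<union> - C)"
        using V C by auto
      ultimately obtain N where "open N" "u \<in> N" "\<And>z. z \<in> N \<Longrightarrow> F z \<subseteq> V \<union> - C"
        using uscD cF(1) by metis
      then show ?thesis
        using U True by (intro exI[of _ "N \<inter> U"]) (auto simp: G_def)
    next
      case False
      then have "F u \<subseteq> V"
        using V by (simp add: G_def)
      then obtain N where "open N" "u \<in> N" "\<And>z. z \<in> N \<Longrightarrow> F z \<subseteq> V"
        using uscD cF(1) V by metis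
      then show ?thesis
        using GF by blast
    qed
  qed
  moreover have "G u \<noteq> {} \<and> compact (G u) \<and> convex (G u)" for u
    using cF meet C by (auto simp: G_def intro: compact_Int_closed convex_Int)
  ultimately have "G = F"
    using F GF unfolding minimal_cusco_def cusco_def usco_def by blast
  then have "G x = F x"
    by simp
  then show ?thesis
    using x by (auto simp: G_def)
qed

text \<open>The compact set \<open>F x - V\<close> lies in a compact convex subset of \<open>F x\<close> that misses the extreme
  point \<open>e\<close>; by minimality, \<open>F\<close> cannot meet a closed convex neighbourhood of it at every
  point near \<open>x\<close>.\<close>

lemma minimal_cusco_extreme_point:
  fixes F :: "'a::topological_space \<Rightarrow> 'b::{t2_space, locally_convex_real_vector} set"
  assumes F: "minimal_cusco F" and e: "e extreme_point_of F x"
    and V: "open V" "e \<in> V" and U: "open U" "x \<in> U"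
  obtains G where "open G" "G \<noteq> {}" "G \<subseteq> U" "\<And>z. z \<in> G \<Longrightarrow> F z \<subseteq> V"
proof -
  have cF: "usc F" "compact (F x)" "convex (F x)"
    using F unfolding minimal_cusco_def cusco_def usco_def by auto
  \<comment> \<open>Convex neighbourhoods whose closures miss \<open>e\<close>: traces of finitely
    many closures on \<open>F x\<close> are later merged by joins.\<close>
  have "\<exists>Q. open Q \<and> convex Q \<and> y \<in> Q \<and> e \<notin> closure Q" if "y \<in> F x - V" for y
    using compact_convex_nhds[of "{y}" "- {e}"] that V(2) by auto
  then obtain Q where Q: "\<And>y. y \<in> F x - V \<Longrightarrow>
      open (Q y) \<and> convex (Q y) \<and> y \<in> Q y \<and> e \<notin> closure (Q y)"
    by metis
  have "compact (F x - V)"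
    using cF(2) V(1) by (rule compact_diff)
  moreover have "F x - V \<subseteq> (\<Union>y\<in>F x - V. Q y)"
    using Q by blast
  ultimately obtain D where D: "D \<subseteq> F x - V" "finite D" "F x - V \<subseteq> (\<Union>y\<in>D. Q y)"
    using compactE_image[of "F x - V" "F x - V" Q] Q by metis
  have "\<exists>K. compact K \<and> convex K \<and> K \<subseteq> F x \<and> e \<notin> K \<and> \<Union>((\<lambda>y. F x \<inter> closure (Q y)) ` D) \<subseteq> K"
  proof (rule finite_Union_compact_convex_avoiding[OF _ cF(3) e])
    fix K assume "K \<in> (\<lambda>y. F x \<inter> closure (Q y)) ` D"
    then obtain y where y: "y \<in> D" "K = F x \<inter> closure (Q y)"
      by blast
    have "compact K" "convex K"
      unfolding y(2) using Q D(1) y(1) cF convex_closure_tvs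
      by (blast intro: compact_Int_closed convex_Int closed_closure)+
    then show "compact K \<and> convex K \<and> K \<subseteq> F x \<and> e \<notin> K"
      using Q D(1) y by blast
  qed (use D(2) in simp)
  then obtain K where K: "compact K" "convex K" "K \<subseteq> F x" "e \<notin> K"
      "\<Union>((\<lambda>y. F x \<inter> closure (Q y)) ` D) \<subseteq> K"
    by blast
  have FK: "F x - V \<subseteq> K"
  proof
    fix y assume y: "y \<in> F x - V"
    then obtain d where "d \<in> D" "y \<in> Q d"
      using D(3) by blast
    then show "y \<in> K"
      using K(5) y closure_subset[of "Q d"] by blast
  qed
  obtain P where P: "open P" "convex P" "K \<subseteq> P" "closure P \<subseteq> - {e}"
    using compact_convex_nhds[OF K(1,2), of "- {e}"] K(4) by auto
  have "open (V \<union> P)" "F x \<subseteq> V \<union> P"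
    using V P FK by auto
  then obtain N where N: "open N" "x \<in> N" "\<And>u. u \<in> N \<Longrightarrow> F u \<subseteq> V \<union> P"
    using uscD[OF cF(1)] by metis
  have "\<exists>u\<in>N \<inter> U. F u \<inter> closure P = {}"
  proof (rule ccontr)
    assume "\<not> ?thesis"
    then have "F x \<subseteq> closure P"
      using minimal_cusco_subset[OF F, of "N \<inter> U" "closure P" x] N U convex_closure_tvs[OF P(2)]
      by blast
    then show False
      using P(4) e unfolding extreme_point_of_def by blast
  qed
  then obtain u where u: "u \<in> N \<inter> U" "F u \<subseteq> - closure P"
    by blast
  \<comment> \<open>Near \<open>u\<close>, \<open>F\<close> stays outside \<open>closure P\<close>,
    while on \<open>N\<close> its values lie in \<open>V \<union> P\<close>; on the intersection
    they lie in \<open>V\<close>.\<close>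
  then obtain M where M: "open M" "u \<in> M" "\<And>z. z \<in> M \<Longrightarrow> F z \<subseteq> - closure P"
    using uscD[OF cF(1) _ u(2)] by blast
  show ?thesis
  proof (rule that[of "M \<inter> (N \<inter> U)"])
    show "F z \<subseteq> V" if "z \<in> M \<inter> (N \<inter> U)" for z
      using N(3)[of z] M(3)[of z] that closure_subset[of P] by blast
  qed (use M N U u in auto)
qed

theorem theorem3p1:
  fixes F :: "'a::t2_space \<Rightarrow> 'b::{t2_space, locally_convex_real_vector} set"
  defines "S1 \<equiv> minimal_cusco F"
    and "S2 \<equiv> (\<forall>x. F x \<noteq> {} \<and> compact (F x) \<and> convex (F x)) \<and> closed (map_graph F) \<and>
      (\<forall>f. extreme_function F f \<longrightarrow> quasicontinuous f \<and> subcontinuous f) \<and>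
      (\<forall>f g. extreme_function F f \<and> extreme_function F g \<longrightarrow>
        closure (fun_graph f) = closure (fun_graph g))"
    and "S3 \<equiv> (\<forall>x. F x \<noteq> {} \<and> compact (F x)) \<and>
      (\<forall>f. extreme_function F f \<longrightarrow> quasicontinuous f \<and> subcontinuous f \<and>
        (\<forall>x. F x = closed_convex_hull (closure_map f x)))"
  shows "(S1 \<longleftrightarrow> S2) \<and> (S2 \<longleftrightarrow> S3)"
proof -
  have in_F: "f x \<in> F x" if "extreme_function F f" for f x
    using that unfolding extreme_function_def extreme_point_of_def by blast
  have S2 if S1
  proof -
    have F: "minimal_cusco F"
      using that by (simp add: S1_def)
    then have cF: "cusco F"
      by (simp add: minimal_cusco_def)
    then have uF: "usco F" and vals: "\<And>x. F x \<noteq> {} \<and> compact (F x) \<and> convex (F x)"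
      unfolding cusco_def usco_def by auto
    \<comment> \<open>Containment of the whole of \<open>F z\<close> in \<open>V\<close> controls
      every extreme function on \<open>G\<close> at once.\<close>
    have small: "\<exists>G. open G \<and> G \<noteq> {} \<and> G \<subseteq> U \<and> (\<forall>z\<in>G. F z \<subseteq> V)"
      if "extreme_function F f" "open V" "f x \<in> V" "open U" "x \<in> U" for f x U V
      using minimal_cusco_extreme_point[OF F _ that(2-5)] that(1)
      unfolding extreme_function_def by metis
    have "quasicontinuous f" if f: "extreme_function F f" for f
      unfolding quasicontinuous_def
    proof (intro allI impI)
      fix x V U assume *: "f x \<in> interior V \<and> open U \<and> x \<in> U"
      obtain G where "open G" "G \<noteq> {}" "G \<subseteq> U" "\<forall>z\<in>G. F z \<subseteq> interior V"
        using small[OF f open_interior, of x V U] * by blast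
      then show "\<exists>G. open G \<and> G \<noteq> {} \<and> G \<subseteq> U \<and> f ` G \<subseteq> V"
        using in_F[OF f] interior_subset[of V] by blast
    qed
    moreover have "closure (fun_graph f) \<subseteq> closure (fun_graph g)"
      if f: "extreme_function F f" and g: "extreme_function F g" for f g
    proof (rule closure_minimal)
      show "fun_graph f \<subseteq> closure (fun_graph g)"
      proof
        fix p assume "p \<in> fun_graph f"
        then obtain x where p: "p = (x, f x)"
          by (auto simp: fun_graph_def)
        show "p \<in> closure (fun_graph g)"
          unfolding p in_closure_fun_graph_iff
        proof (intro allI impI)
          fix U V assume *: "open U \<and> x \<in> U \<and> open V \<and> f x \<in> V"
          obtain G where "G \<noteq> {}" "G \<subseteq> U" "\<forall>z\<in>G. F z \<subseteq> V"
            using small[OF f, of V x U] * by blast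
          then show "\<exists>u\<in>U. g u \<in> V"
            using in_F[OF g] by blast
        qed
      qed
    qed simp
    moreover have "subcontinuous f" if "extreme_function F f" for f
      using usco_selection_subcontinuous[OF uF] in_F[OF that] by blast
    ultimately show S2
      unfolding S2_def using vals closed_map_graph_cusco[OF cF] by blast
  qed
  moreover have S3 if S2
  proof -
    have vals: "\<And>x. F x \<noteq> {} \<and> compact (F x) \<and> convex (F x)"
      and cl: "closed (map_graph F)"
      and ext: "\<And>f. extreme_function F f \<Longrightarrow> quasicontinuous f \<and> subcontinuous f"
      and same: "\<And>f g. extreme_function F f \<Longrightarrow> extreme_function F g \<Longrightarrow>
        closure (fun_graph f) = closure (fun_graph g)"
      using \<open>S2\<close> unfolding S2_def by blast+
    have "F x = closed_convex_hull (closure_map f x)" if f: "extreme_function F f" for f x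
    proof (rule ccontr)
      assume neq: "F x \<noteq> closed_convex_hull (closure_map f x)"
      have "closure (fun_graph f) \<subseteq> map_graph F"
        using in_F[OF f] by (intro closure_minimal cl) (auto simp: fun_graph_def map_graph_def)
      then have "closure_map f x \<subseteq> F x"
        by (auto simp: closure_map_def map_graph_def)
      then have "closed_convex_hull (closure_map f x) \<subseteq> F x"
        using vals compact_imp_closed by (intro closed_convex_hull_minimal) auto
      then obtain e where e: "e extreme_point_of F x" "e \<notin> closed_convex_hull (closure_map f x)"
        using extreme_point_outside_closed[of "F x" "closed_convex_hull (closure_map f x)"] vals neq
          closed_closed_convex_hull convex_closed_convex_hull by metis
      \<comment> \<open>Redefining \<open>f\<close> at \<open>x\<close> alone keeps it extreme; the
        new graph contains \<open>(x, e)\<close>, and equality of closures places this point in the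
        graph closure of \<open>f\<close>.\<close>
      have "extreme_function F (f(x := e))"
        using f e(1) by (simp add: extreme_function_def)
      then have "closure_map (f(x := e)) x = closure_map f x"
        unfolding closure_map_def using same f by metis
      then have "e \<in> closure_map f x"
        using in_closure_map[of "f(x := e)" x] by simp
      then show False
        using e(2) subset_closed_convex_hull by blast
    qed
    then show S3
      unfolding S3_def using vals ext by blast
  qed
  moreover have S1 if S3
  proof -
    have vals: "\<And>x. F x \<noteq> {} \<and> compact (F x)"
      and ext: "\<And>f. extreme_function F f \<Longrightarrow> quasicontinuous f" "\<And>f. extreme_function F f \<Longrightarrow> subcontinuous f"
        "\<And>f x. extreme_function F f \<Longrightarrow> F x = closed_convex_hull (closure_map f x)"
      using \<open>S3\<close> unfolding S3_def by blast+
    obtain f where f: "extreme_function F f"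
      using extreme_function_exists[of F] vals by blast
    have cF: "cusco F"
      using cusco_if_closed_convex_hull[OF vals ext(2)[OF f] ext(3)[OF f]] .
    have "G x = F x" if G: "cusco G" and GF: "\<And>x. G x \<subseteq> F x" for G x
    proof (rule ccontr)
      assume "G x \<noteq> F x"
      have cG: "usc G" "\<And>x. G x \<noteq> {}" "compact (G x)" "convex (G x)"
        using G unfolding cusco_def usco_def by auto
      then obtain e where e: "e extreme_point_of F x" "e \<notin> G x"
        using extreme_point_outside_closed[of "F x" "G x"] vals GF compact_imp_closed \<open>G x \<noteq> F x\<close>
        by metis
      \<comment> \<open>An extreme function through the missed point \<open>e\<close>;
        quasicontinuity keeps it close to \<open>e\<close> on an open set near \<open>x\<close>, not
        necessarily containing \<open>x\<close>.\<close>
      define h where "h = f(x := e)"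
      have h: "extreme_function F h"
        using f e(1) by (simp add: extreme_function_def h_def)
      obtain Q where Q: "open Q" "G x \<subseteq> Q" "closure Q \<subseteq> - {e}"
        using compact_convex_nhds[OF cG(3,4), of "- {e}"] e(2) by auto
      obtain P where P: "open P" "convex P" "e \<in> P" "closure P \<subseteq> - closure Q"
        using compact_convex_nhds[of "{e}" "- closure Q"] Q(3) by auto
      obtain U where U: "open U" "x \<in> U" "\<And>u. u \<in> U \<Longrightarrow> G u \<subseteq> Q"
        using uscD[OF cG(1) Q(1,2)] by blast
      have "h x \<in> interior P"
        using P by (simp add: h_def interior_open)
      then obtain W where W: "open W" "W \<noteq> {}" "W \<subseteq> U" "h ` W \<subseteq> P"
        using ext(1)[OF h] U unfolding quasicontinuous_def by meson
      obtain w where w: "w \<in> W"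
        using W(2) by blast
      \<comment> \<open>The hull formula is used for \<open>h\<close> rather than \<open>f\<close>:
        values of \<open>h\<close> near \<open>w\<close> lie in the convex set
        \<open>P\<close>.\<close>
      have "F w \<subseteq> closure P"
        unfolding ext(3)[OF h, of w]
        using closure_map_subset_closure[OF W(1) w W(4)] convex_closure_tvs[OF P(2)]
        by (intro closed_convex_hull_minimal) auto
      \<comment> \<open>\<open>G w\<close> is nonempty and contained in both \<open>Q\<close> and
        \<open>F w\<close>, yet \<open>F w\<close> misses \<open>closure Q\<close>.\<close>
      then show False
        using GF[of w] cG(2)[of w] U(3)[of w] w W(3) P(4) closure_subset[of Q] by blast
    qed
    then show S1
      unfolding S1_def minimal_cusco_def using cF by blast
  qed
  ultimately show ?thesis
    by blast
qed

end
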